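(* Let $T$ be a tournament on $n$ vertices. If $\pi_2(T) > (7n-10)/36$, then $T$ is path extendable.
   Context: For distinct vertices $u,v$ of a tournament $T$, $p_2(u,v)$ denotes the number of directed paths of length $2$ (with $2$ arcs) from $u$ to $v$ in $T$, and $\pi_2(T)=\min\{p_2(u,v) : u,v\in V(T),\ u\neq v\}$. All paths are directed paths. A path $P$ that is not hamiltonian is called extendable if there is a path $P'$ with the same initial and the same terminal vertex as $P$ and $V(P')=V(P)\cup\{w\}$ for some vertex $w\in V(T)\setminus V(P)$. A digraph is path extendable if every nonhamiltonian path of length at least $1$ in it is extendable. *)

theory Defs
  imports Complex_Main "Graph_Theory.Vertex_Walk"
begin

locale tournament = digraph +
  assumes semicomplete:
      "\<lbrakk>u \<in> verts G; v \<in> verts G; u \<noteq> v\<rbrakk> \<Longrightarrow> u \<rightarrow> v \<or> v \<rightarrow> u"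
    and asymmetric: "u \<rightarrow> v \<Longrightarrow> \<not> v \<rightarrow> u"

text \<open>
  Directed paths are given by their vertex sequences (\<^const>\<open>vpath\<close>); this loses nothing
  in a digraph without parallel arcs. The length \<^const>\<open>vwalk_length\<close> counts arcs.
\<close>

definition p2 :: "('a, 'b) pre_digraph \<Rightarrow> 'a \<Rightarrow> 'a \<Rightarrow> nat" where
  "p2 G u v = card {p. vpath p G \<and> vwalk_length p = 2 \<and> hd p = u \<and> last p = v}"

text \<open>
  For a digraph with fewer than two vertices the minimum below is over the empty set and its
  value is unspecified; such a digraph has no path of length at least 1.
\<close>

definition pi2 :: "('a, 'b) pre_digraph \<Rightarrow> nat" where
  "pi2 G = Min {p2 G u v | u v. u \<in> verts G \<and> v \<in> verts G \<and> u \<noteq> v}"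

definition hamiltonian_path :: "'a vwalk \<Rightarrow> ('a, 'b) pre_digraph \<Rightarrow> bool" where
  "hamiltonian_path p G \<longleftrightarrow> vpath p G \<and> set p = verts G"

definition extendable :: "'a vwalk \<Rightarrow> ('a, 'b) pre_digraph \<Rightarrow> bool" where
  "extendable p G \<longleftrightarrow>
    (\<exists>p' w. vpath p' G \<and> hd p' = hd p \<and> last p' = last p \<and>
            w \<in> verts G - set p \<and> set p' = set p \<union> {w})"

definition path_extendable :: "('a, 'b) pre_digraph \<Rightarrow> bool" where
  "path_extendable G \<longleftrightarrow>
    (\<forall>p. vpath p G \<and> \<not> hamiltonian_path p G \<and> vwalk_length p \<ge> 1 \<longrightarrow> extendable p G)"

end

theory Submission
  imports Defs
begin

text \<open>
  Let x be the minimum number of 2-paths, so that 7 n \<le> 36 x + 9, and let v_1, ..., v_p be a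
  path that cannot be extended. A vertex w off the path cannot be inserted, so it dominates
  precisely an initial segment v_1, ..., v_t of the path. Hence all 2-paths from v_i to v_j with
  i < j stay on the path, and all 2-paths from w to w' with t(w) \<le> t(w') stay off it.

  If 2 \<le> t(w) \<le> p - 2, the path v_1 v_k ... v_i w v_2 ... v_{k-1} v_{i+1} ... v_p must be
  blocked. Since v_1 has at least 2x + 1 out-neighbours v_k on the path, at least 2x path vertices
  v_{k-1} have almost no forward arcs, and the x many 2-paths from one of them to v_p avoid the
  others; this gives p \<ge> 3x. If w is the only vertex off the path, the same idea applied to
  2-paths ending in w gives p - t \<ge> 3x, and reversing all arcs t \<ge> 3x, so n > 6x, which is
  too large. Otherwise, summing out-degrees over the r vertices off the path, ordered by t, yields
  r (r - 1 - 2x) \<ge> x (x + 1), which together with p \<ge> 3x is again too large.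
  If no w satisfies 2 \<le> t(w) \<le> p - 2, then almost all 2-paths between path vertices stay on the
  path, so p is about 4x while r > 2x, a contradiction as before.
\<close>

section \<open>Degree counting in tournaments\<close>

lemma sum_outdegrees_tournament:
  fixes F :: "'a \<Rightarrow> 'a \<Rightarrow> bool"
  assumes fin: "finite A"
    and tour: "\<And>u v. u \<in> A \<Longrightarrow> v \<in> A \<Longrightarrow> u \<noteq> v \<Longrightarrow> F u v \<longleftrightarrow> \<not> F v u"
    and irrefl: "\<And>u. \<not> F u u"
  shows "2 * (\<Sum>u\<in>A. card {v \<in> A. F u v}) = card A * (card A - 1)"
proof -
  have deg: "card {v \<in> A. Q v} = (\<Sum>v\<in>A. if Q v then 1 else 0)" for Q
    using fin by (simp add: sum.If_cases Int_def)
  let ?g = "\<lambda>u v. if F u v then 1 else (0::nat)"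
  \<comment> \<open>Swapping the summation order in one of the two copies lets every ordered pair of
    distinct vertices contribute exactly 1.\<close>
  have "2 * (\<Sum>u\<in>A. card {v \<in> A. F u v}) = (\<Sum>u\<in>A. \<Sum>v\<in>A. ?g u v) + (\<Sum>u\<in>A. \<Sum>v\<in>A. ?g v u)"
    unfolding deg mult_2 by (subst (2) sum.swap) simp
  also have "\<dots> = (\<Sum>u\<in>A. \<Sum>v\<in>A. if v \<noteq> u then 1 else 0)"
    unfolding sum.distrib[symmetric]
  proof (intro sum.cong refl)
    fix u v assume "u \<in> A" "v \<in> A"
    then show "?g u v + ?g v u = (if v \<noteq> u then 1 else 0)"
      using tour[of u v] irrefl[of u] by (cases "F u v") auto
  qed
  also have "\<dots> = (\<Sum>u\<in>A. card (A - {u}))"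
    unfolding deg[symmetric] by (intro sum.cong refl arg_cong[where f = card]) auto
  also have "\<dots> = card A * (card A - 1)"
    using fin by simp
  finally show ?thesis .
qed

text \<open>Averaging: the mean out-degree inside \<open>A\<close> is (|A| - 1)/2, and a vertex of
  \<open>A\<close> has at most |B - A| further out-neighbours in \<open>B\<close>. In the
  applications \<open>B\<close> is the out- or in-neighbourhood of a vertex u, and
  \<open>deg\<close> says that 2-paths from or to u have their middle vertex in \<open>B\<close>;
  for out-neighbourhoods \<open>F\<close> is the reversed arc relation.\<close>

lemma outdegree_bound:
  fixes F :: "'a \<Rightarrow> 'a \<Rightarrow> bool"
  assumes fin: "finite B" and sub: "A \<subseteq> B" and ne: "A \<noteq> {}"
    and tour: "\<And>u v. u \<in> A \<Longrightarrow> v \<in> A \<Longrightarrow> u \<noteq> v \<Longrightarrow> F u v \<longleftrightarrow> \<not> F v u"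
    and irrefl: "\<And>u. \<not> F u u"
    and deg: "\<And>u. u \<in> A \<Longrightarrow> x \<le> card {v \<in> B. F u v}"
  shows "2 * x + 1 \<le> card A + 2 * card (B - A)"
proof (rule ccontr)
  assume neg: "\<not> ?thesis"
  have finA: "finite A" using fin sub by (rule rev_finite_subset)
  have pos: "card A > 0" using finA ne by (simp add: card_gt_0_iff)
  have "x \<le> card {v \<in> A. F u v} + card (B - A)" if "u \<in> A" for u
  proof -
    have "{v \<in> B. F u v} \<subseteq> {v \<in> A. F u v} \<union> (B - A)" by auto
    then have "card {v \<in> B. F u v} \<le> card ({v \<in> A. F u v} \<union> (B - A))"
      using fin finA by (intro card_mono) auto
    also have "\<dots> \<le> card {v \<in> A. F u v} + card (B - A)" by (rule card_Un_le)
    finally show ?thesis using deg[OF that] by linarith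
  qed
  then have "(\<Sum>u\<in>A. x) \<le> (\<Sum>u\<in>A. card {v \<in> A. F u v} + card (B - A))"
    by (rule sum_mono)
  then have "2 * (card A * x) \<le> card A * (card A - 1) + 2 * (card A * card (B - A))"
    using sum_outdegrees_tournament[of A F, OF finA tour irrefl] by (simp add: sum.distrib)
  also have "\<dots> = card A * (card A - 1 + 2 * card (B - A))" by (simp add: algebra_simps)
  finally have "card A * (2 * x) \<le> card A * (card A - 1 + 2 * card (B - A))"
    by (simp add: mult.left_commute)
  then have "2 * x \<le> card A - 1 + 2 * card (B - A)" using pos by simp
  then show False using neg pos by linarith
qed

text \<open>The out-degrees sum to m (m - 1)/2. All but the last are at least x, because of the
  2-paths to m - 1. For i < x the out-degree is even at least 2x + 1 - i: at most i out-neighbours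
  precede i, and averaging applies to the later ones.\<close>

lemma ordered_two_paths_card:
  fixes F :: "nat \<Rightarrow> nat \<Rightarrow> bool"
  assumes tour: "\<And>i j. i < m \<Longrightarrow> j < m \<Longrightarrow> i \<noteq> j \<Longrightarrow> F i j \<longleftrightarrow> \<not> F j i"
    and irrefl: "\<And>i. \<not> F i i"
    and two: "\<And>i j. i < j \<Longrightarrow> j < m \<Longrightarrow> x \<le> card {k \<in> {..<m}. F i k \<and> F k j}"
    and m: "2 \<le> m"
  shows "m + 2 * x * m + x * x + x \<le> m * m"
proof -
  define d where "d i = card {k \<in> {..<m}. F i k}" for i
  have dx: "x \<le> d i" if "i < m - 1" for i
  proof -
    have "{k \<in> {..<m}. F i k \<and> F k (m - 1)} \<subseteq> {k \<in> {..<m}. F i k}" by auto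
    then have "card {k \<in> {..<m}. F i k \<and> F k (m - 1)} \<le> d i"
      unfolding d_def by (intro card_mono) auto
    then show ?thesis using two[of i "m - 1"] that m by linarith
  qed
  have xm: "x < m"
  proof -
    have "d 0 \<le> card {1..<m}"
      unfolding d_def
    proof (intro card_mono subsetI)
      fix k assume "k \<in> {k \<in> {..<m}. F 0 k}"
      then show "k \<in> {1..<m}" using irrefl[of 0] by (cases k) auto
    qed simp
    then show ?thesis using dx[of 0] m by auto
  qed
  have dlow: "2 * x + 1 \<le> d i + i" if i: "i < x" for i
  proof -
    define A where "A = {k \<in> {..<m}. F i k \<and> i < k}"
    define B where "B = {k \<in> {..<m}. F i k}"
    have im: "i < m - 1" using i xm by linarith
    have AB: "A \<subseteq> B" and finB: "finite B" unfolding A_def B_def by auto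
    have BA: "B - A \<subseteq> {..<i}"
    proof
      fix k assume "k \<in> B - A"
      then show "k \<in> {..<i}" unfolding A_def B_def using irrefl[of i] by (cases "k = i") auto
    qed
    then have cBA: "card (B - A) \<le> i" using card_mono[OF _ BA] by simp
    have split: "card B = card A + card (B - A)"
      using card_Diff_subset[OF finite_subset[OF AB finB] AB] card_mono[OF finB AB] by linarith
    have "A \<noteq> {}"
    proof
      assume "A = {}"
      then have "card B \<le> i" using cBA by simp
      then show False using dx[OF im] i unfolding d_def B_def[symmetric] by linarith
    qed
    moreover have "x \<le> card {v \<in> B. F v u}" if "u \<in> A" for u
      using two[of i u] that unfolding A_def B_def by (simp add: conj_assoc)
    moreover have "F v u \<longleftrightarrow> \<not> F u v" if "u \<in> A" "v \<in> A" "u \<noteq> v" for u v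
      using tour[of v u] that unfolding A_def by simp
    ultimately have "2 * x + 1 \<le> card A + 2 * card (B - A)"
      using irrefl by (intro outdegree_bound[of B A "\<lambda>u v. F v u" x, OF finB AB])
    then show ?thesis unfolding d_def B_def[symmetric] using split cBA by linarith
  qed
  have gauss: "2 * (\<Sum>i<k. i) + k = k * k" for k :: nat
    by (induction k) auto
  \<comment> \<open>\<open>c\<close> counts the indices from x to m - 2, where only
    \<open>x \<le> d i\<close> is used; \<open>d (m - 1)\<close> is bounded below by 0 only.\<close>
  obtain c where c: "m = Suc (x + c)" using less_imp_Suc_add[OF xm] by blast
  have low: "x * (2 * x + 1) \<le> (\<Sum>i<x. d i) + (\<Sum>i<x. i)"
    using sum_mono[of "{..<x}" "\<lambda>_. 2 * x + 1" "\<lambda>i. d i + i"] dlow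
    by (simp add: sum.distrib)
  have high: "c * x \<le> (\<Sum>i\<in>{x..<x + c}. d i)"
    using sum_mono[of "{x..<x + c}" "\<lambda>_. x" d] dx c by simp
  have "(\<Sum>i<x. d i) + (\<Sum>i\<in>{x..<x + c}. d i) = (\<Sum>i<x + c. d i)"
    using sum.atLeastLessThan_concat[of 0 x "x + c" d] by (simp add: atLeast0LessThan)
  then have "(\<Sum>i<x. d i) + (\<Sum>i\<in>{x..<x + c}. d i) \<le> (\<Sum>i<m. d i)"
    unfolding c by simp
  moreover have "2 * (\<Sum>i<m. d i) = m * (m - 1)"
  proof -
    have "F i j \<longleftrightarrow> \<not> F j i" if "i \<in> {..<m}" "j \<in> {..<m}" "i \<noteq> j" for i j
      using that by (intro tour) auto
    from sum_outdegrees_tournament[of "{..<m}" F, OF _ this irrefl] show ?thesis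
      unfolding d_def by simp
  qed
  ultimately have "2 * (x * (2 * x + 1)) + 2 * (c * x) + x \<le> m * (m - 1) + x * x"
    using low high gauss[of x] by linarith
  then show ?thesis unfolding c by (simp add: algebra_simps)
qed

section \<open>Paths that cannot be extended\<close>

text \<open>
  The path is f 1, ..., f p. The assumptions only forbid the two kinds of extension that the proof
  uses, and they are invariant under reversing all arcs together with the path.
\<close>

locale stuck_path =
  fixes V :: "'a set" and E :: "'a \<Rightarrow> 'a \<Rightarrow> bool" and f :: "nat \<Rightarrow> 'a" and p x :: nat
  assumes fin: "finite V"
    and total: "\<lbrakk>u \<in> V; v \<in> V; u \<noteq> v\<rbrakk> \<Longrightarrow> E u v \<or> E v u"
    and asym: "E u v \<Longrightarrow> \<not> E v u"
    and two_paths: "\<lbrakk>u \<in> V; v \<in> V; u \<noteq> v\<rbrakk> \<Longrightarrow> x \<le> card {w \<in> V. E u w \<and> E w v}"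
    and two_le_p: "2 \<le> p"
    and inj: "inj_on f {1..p}"
    and path_psubset: "f ` {1..p} \<subset> V"
    and arc: "\<lbrakk>1 \<le> i; i < p\<rbrakk> \<Longrightarrow> E (f i) (f (Suc i))"
    and no_insertion:
      "\<lbrakk>w \<in> V - f ` {1..p}; 1 \<le> i; i < p; E (f i) w\<rbrakk> \<Longrightarrow> \<not> E w (f (Suc i))"
    and no_exchange:
      "\<lbrakk>w \<in> V - f ` {1..p}; 2 \<le> j; j < k; k \<le> i; i < p; E (f i) w; E w (f j);
        E (f (j - 1)) (f k)\<rbrakk> \<Longrightarrow> \<not> E (f (k - 1)) (f (Suc i))"
    and card_bound: "7 * card V \<le> 36 * x + 9"
begin

section \<open>Thresholds of the vertices off the path\<close>

definition R :: "'a set" where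
  "R = V - f ` {1..p}"

text \<open>For \<open>w\<close> in \<open>R\<close> this turns out to be the last index that
  \<open>w\<close> dominates; counting instead of taking a maximum gives 0 when there is
  none.\<close>

definition t :: "'a \<Rightarrow> nat" where
  "t w = card {i \<in> {1..p}. E w (f i)}"

lemma irrefl: "\<not> E u u"
  using asym by blast

lemma f_in_V: "\<lbrakk>1 \<le> i; i \<le> p\<rbrakk> \<Longrightarrow> f i \<in> V"
  using psubset_imp_subset[OF path_psubset] by auto

lemma f_eq_iff: "\<lbrakk>1 \<le> i; i \<le> p; 1 \<le> j; j \<le> p\<rbrakk> \<Longrightarrow> f i = f j \<longleftrightarrow> i = j"
  using inj_on_eq_iff[OF inj, of i j] by simp

lemma card_V: "card V = p + card R"
  unfolding R_def using card_Diff_subset[of "f ` {1..p}" V] path_psubset card_image[OF inj]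
    card_mono[OF fin, of "f ` {1..p}"] by auto

lemma finite_R: "finite R"
  unfolding R_def using fin by simp

lemma card_R_pos: "1 \<le> card R"
  using path_psubset card_gt_0_iff[of R] finite_R unfolding R_def by auto

lemma x_pos: "1 \<le> x"
  using card_bound card_V card_R_pos two_le_p by linarith

lemma reverse_image: "(\<lambda>i. f (Suc p - i)) ` {1..p} = f ` {1..p}"
proof -
  have "(\<lambda>i. Suc p - i) ` {1..p} = {1..p}"
  proof
    show "{1..p} \<subseteq> (\<lambda>i. Suc p - i) ` {1..p}"
    proof
      fix i assume "i \<in> {1..p}"
      then show "i \<in> (\<lambda>i. Suc p - i) ` {1..p}" by (intro image_eqI[of _ _ "Suc p - i"]) auto
    qed
  qed auto
  then show ?thesis by (metis image_image)
qed

lemma on_path: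
  assumes "v \<in> V" "v \<notin> R"
  obtains i where "v = f i" "1 \<le> i" "i \<le> p"
  using assms unfolding R_def by fastforce

text \<open>Duality: bounds on out-degrees yield bounds on in-degrees, and a bound on
  \<open>p - t w\<close> yields one on \<open>t w\<close>.\<close>

lemma stuck_path_reverse: "stuck_path V (\<lambda>u v. E v u) (\<lambda>i. f (Suc p - i)) p x"
proof -
  show ?thesis
  proof (unfold_locales, unfold reverse_image)
    show "inj_on (\<lambda>i. f (Suc p - i)) {1..p}"
    proof (rule inj_onI)
      fix i j assume "i \<in> {1..p}" "j \<in> {1..p}" "f (Suc p - i) = f (Suc p - j)"
      then have "Suc p - i = Suc p - j" and "i \<le> p" "j \<le> p"
        using f_eq_iff[of "Suc p - i" "Suc p - j"] by fastforce+
      then show "i = j" by linarith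
    qed
  next
    fix i assume "1 \<le> i" "i < p"
    then show "E (f (Suc p - Suc i)) (f (Suc p - i))"
      using arc[of "p - i"] by (simp add: Suc_diff_le)
  next
    fix w i assume "w \<in> V - f ` {1..p}" "1 \<le> i" "i < p" "E w (f (Suc p - i))"
    then show "\<not> E (f (Suc p - Suc i)) w"
      using no_insertion[of w "p - i"] by (auto simp: Suc_diff_le Suc_le_eq)
  next
    fix w i j k
    assume w: "w \<in> V - f ` {1..p}" and ineq: "2 \<le> j" "j < k" "k \<le> i" "i < p"
      and a: "E w (f (Suc p - i))" "E (f (Suc p - j)) w" "E (f (Suc p - k)) (f (Suc p - (j - 1)))"
    have eqs: "Suc (Suc p - j) = Suc p - (j - 1)" "Suc (Suc p) - k - 1 = Suc p - k"
      "Suc p - i - 1 = Suc p - Suc i" "Suc (Suc p) - k = Suc p - (k - 1)"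
      using ineq by linarith+
    show "\<not> E (f (Suc p - Suc i)) (f (Suc p - (k - 1)))"
    proof -
      \<comment> \<open>Reversal turns the exchange at (j, k, i) into the one at (p + 1 - i, p + 2 -
        k, p + 1 - j). The two path-to-path arcs of the exchange trade places, hence the
        contrapositive form.\<close>
      have "\<not> E (f (Suc (Suc p) - k - 1)) (f (Suc (Suc p - j)))"
        if "E (f (Suc p - i - 1)) (f (Suc (Suc p) - k))"
        using w ineq a(1,2) that
        by (intro no_exchange[of w "Suc p - i" "Suc (Suc p) - k" "Suc p - j"]) linarith+
      then show ?thesis using a(3) eqs by metis
    qed
  qed (use fin total asym two_paths two_le_p path_psubset card_bound in \<open>auto simp: conj_commute\<close>)
qed

text \<open>If \<open>w\<close> dominates \<open>f (Suc m)\<close>, then an arc from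
  \<open>f m\<close> to \<open>w\<close> would allow inserting \<open>w\<close> between them, so
  \<open>w\<close> dominates \<open>f m\<close> as well. The dominated indices are therefore closed
  downwards.\<close>

lemma E_iff_le_t:
  assumes w: "w \<in> R" and i: "1 \<le> i" "i \<le> p"
  shows "E w (f i) \<longleftrightarrow> i \<le> t w"
proof -
  define S where "S = {i \<in> {1..p}. E w (f i)}"
  have down: "j \<in> S" if "k \<in> S" "1 \<le> j" "j \<le> k" for j k
    using \<open>j \<le> k\<close>
  proof (induction rule: inc_induct)
    case base
    show ?case using that by simp
  next
    case (step m)
    then have m: "1 \<le> m" "m < p" "E w (f (Suc m))" using that unfolding S_def by auto
    have "w \<noteq> f m" using w m unfolding R_def by auto
    then have "E w (f m)"
      using no_insertion[of w m] total[of w "f m"] w m f_in_V[of m] unfolding R_def by auto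
    then show ?case using m unfolding S_def by auto
  qed
  have "S = {1..card S}"
  proof (cases "S = {}")
    case False
    have finS: "finite S" unfolding S_def by simp
    have "S = {1..Max S}"
    proof
      show "S \<subseteq> {1..Max S}" using Max_ge[OF finS] unfolding S_def by auto
      show "{1..Max S} \<subseteq> S" using down[OF Max_in[OF finS False]] by auto
    qed
    moreover from this have "card S = Max S" by (metis card_atLeastAtMost diff_Suc_1)
    ultimately show ?thesis by argo
  qed simp
  moreover have "t w = card S" unfolding t_def S_def by simp
  ultimately have "i \<in> S \<longleftrightarrow> i \<in> {1..t w}" by metis
  then show ?thesis using i unfolding S_def by simp
qed

lemma E_iff_t_less:
  assumes w: "w \<in> R" and i: "1 \<le> i" "i \<le> p"
  shows "E (f i) w \<longleftrightarrow> t w < i"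
proof -
  have "w \<noteq> f i" "w \<in> V" using w i unfolding R_def by auto
  then have "E (f i) w \<longleftrightarrow> \<not> E w (f i)" using total[of w "f i"] f_in_V[OF i] asym by blast
  then show ?thesis using E_iff_le_t[OF assms] by auto
qed

lemma t_le_p: "t w \<le> p"
proof -
  have "t w \<le> card {1..p}" unfolding t_def by (intro card_mono) auto
  then show ?thesis by simp
qed

text \<open>A 2-path from \<open>f i\<close> to \<open>f j\<close> through \<open>w\<close> in
  \<open>R\<close> means \<open>j \<le> t w\<close> and \<open>t w < i\<close>, which
  \<open>no_detour\<close> excludes. For i < j this condition follows by transitivity.\<close>

lemma two_paths_inside:
  assumes i: "1 \<le> i" "i \<le> p" and j: "1 \<le> j" "j \<le> p" and ij: "i \<noteq> j"
    and no_detour: "\<And>w. w \<in> R \<Longrightarrow> t w < i \<Longrightarrow> t w < j"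
  shows "x \<le> card {k \<in> {1..p}. E (f i) (f k) \<and> E (f k) (f j)}" (is "_ \<le> card ?M")
proof -
  have "{w \<in> V. E (f i) w \<and> E w (f j)} \<subseteq> f ` ?M"
  proof
    fix w assume w: "w \<in> {w \<in> V. E (f i) w \<and> E w (f j)}"
    show "w \<in> f ` ?M"
    proof (cases "w \<in> R")
      case True
      then show ?thesis
        using w no_detour[of w] E_iff_t_less[of w i] E_iff_le_t[of w j] i j by auto
    next
      case False
      then show ?thesis using w unfolding R_def by auto
    qed
  qed
  then have "card {w \<in> V. E (f i) w \<and> E w (f j)} \<le> card ?M"
    by (intro surj_card_le) auto
  then show ?thesis
    using two_paths[of "f i" "f j"] f_in_V f_eq_iff i j ij by force
qed

section \<open>Degree bounds in the whole tournament\<close>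

text \<open>All 2-paths from \<open>u\<close> pass through its out-neighbourhood, so each vertex
  there has at least x in-neighbours inside it; averaging then bounds its size.\<close>

lemma outdegree_ge:
  assumes u: "u \<in> V"
  shows "2 * x + 1 \<le> card {v \<in> V. E u v}" (is "_ \<le> card ?N")
proof -
  have *: "x \<le> card {v \<in> ?N. E v w}" if "w \<in> V" "w \<noteq> u" for w
    using two_paths[OF u \<open>w \<in> V\<close>] that by (simp add: conj_assoc)
  have "f 1 \<in> V" "f 2 \<in> V" "f 1 \<noteq> f 2" using f_in_V f_eq_iff two_le_p by auto
  then obtain w where "w \<in> V" "w \<noteq> u" by blast
  then have "?N \<noteq> {}" using *[of w] x_pos by (intro notI) simp
  then have "2 * x + 1 \<le> card ?N + 2 * card (?N - ?N)"
  proof (intro outdegree_bound[of ?N ?N "\<lambda>u v. E v u"])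
    show "E b a \<longleftrightarrow> \<not> E a b" if "a \<in> ?N" "b \<in> ?N" "a \<noteq> b" for a b
      using that total[of a b] asym by blast
    show "x \<le> card {v \<in> ?N. E v a}" if "a \<in> ?N" for a
      using *[of a] that irrefl by blast
  qed (use fin irrefl in auto)
  then show ?thesis by simp
qed

lemma indegree_ge:
  assumes u: "u \<in> V"
  shows "2 * x + 1 \<le> card {v \<in> V. E v u}"
proof -
  interpret rev: stuck_path V "\<lambda>u v. E v u" "\<lambda>i. f (Suc p - i)" p x
    by (rule stuck_path_reverse)
  show ?thesis using rev.outdegree_ge[OF u] .
qed

lemma card_V_ge: "4 * x + 3 \<le> card V"
proof -
  obtain u where u: "u \<in> V" using f_in_V[of 1] two_le_p by auto
  have "{v \<in> V. E u v} \<union> {v \<in> V. E v u} \<subseteq> V - {u}" using irrefl by auto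
  then have "card ({v \<in> V. E u v} \<union> {v \<in> V. E v u}) \<le> card (V - {u})"
    using fin by (intro card_mono) auto
  moreover have "card ({v \<in> V. E u v} \<union> {v \<in> V. E v u})
      = card {v \<in> V. E u v} + card {v \<in> V. E v u}"
    using fin asym by (intro card_Un_disjoint) auto
  moreover have "Suc (card (V - {u})) = card V"
    by (rule card_Suc_Diff1[OF fin u])
  ultimately show ?thesis using outdegree_ge[OF u] indegree_ge[OF u] by linarith
qed

lemma x_ge_2: "2 \<le> x"
  using card_V_ge card_bound by linarith

lemma E_f_iff: "\<lbrakk>1 \<le> i; i \<le> p; 1 \<le> j; j \<le> p; i \<noteq> j\<rbrakk> \<Longrightarrow> E (f i) (f j) \<longleftrightarrow> \<not> E (f j) (f i)"
  using total[of "f i" "f j"] asym f_in_V f_eq_iff by blast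

section \<open>Exchanges starting after the first path vertex\<close>

text \<open>The argument for \<open>outdegree_ge\<close> works within the path, since 2-paths from
  \<open>f 1\<close> to later path vertices stay on it.\<close>

lemma initial_outdegree_ge: "2 * x + 1 \<le> card {k \<in> {2..p}. E (f 1) (f k)}"
  (is "_ \<le> card ?N")
proof -
  have "2 * x + 1 \<le> card ?N + 2 * card (?N - ?N)"
  proof (rule outdegree_bound[of ?N ?N "\<lambda>u v. E (f v) (f u)"])
    show "?N \<noteq> {}" using arc[of 1] two_le_p by (auto simp: numeral_2_eq_2)
    show "E (f j) (f i) \<longleftrightarrow> \<not> E (f i) (f j)" if "i \<in> ?N" "j \<in> ?N" "i \<noteq> j" for i j
      using that E_f_iff[of j i] by auto
    show "x \<le> card {k \<in> ?N. E (f k) (f j)}" if "j \<in> ?N" for j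
    proof -
      have "k = 1 \<or> k \<in> {2..p}" if "k \<in> {1..p}" for k using that by auto
      then have "{k \<in> {1..p}. E (f 1) (f k) \<and> E (f k) (f j)} \<subseteq> {k \<in> ?N. E (f k) (f j)}"
        using irrefl by blast
      then have "card {k \<in> {1..p}. E (f 1) (f k) \<and> E (f k) (f j)} \<le> card {k \<in> ?N. E (f k) (f j)}"
        by (intro card_mono) auto
      then show ?thesis using two_paths_inside[of 1 j] that two_le_p by fastforce
    qed
  qed (use irrefl in auto)
  then show ?thesis by simp
qed

lemma p_ge: "2 * x + 2 \<le> p"
proof -
  have "card {k \<in> {2..p}. E (f 1) (f k)} \<le> card {2..p}" by (intro card_mono) auto
  then show ?thesis using initial_outdegree_ge by simp
qed

text \<open>The block f 2, ..., f k can be postponed, as \<open>f 1\<close> has an arc to the vertex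
  after it. Requiring \<open>2 \<le> k\<close> keeps the block nonempty and costs one out-neighbour,
  \<open>f 2\<close>, in the count.\<close>

definition K :: "nat set" where
  "K = {k \<in> {2..<p}. E (f 1) (f (Suc k))}"

lemma finite_K: "finite K"
  unfolding K_def by simp

lemma card_K_ge: "2 * x \<le> card K"
proof -
  have "{k \<in> {2..p}. E (f 1) (f k)} \<subseteq> insert 2 (Suc ` K)"
  proof
    fix k assume k: "k \<in> {k \<in> {2..p}. E (f 1) (f k)}"
    show "k \<in> insert 2 (Suc ` K)"
    proof (cases "k = 2")
      case False
      then have "k = Suc (k - 1)" "k - 1 \<in> K" using k unfolding K_def by auto
      then show ?thesis by blast
    qed simp
  qed
  then have "card {k \<in> {2..p}. E (f 1) (f k)} \<le> card (insert 2 (Suc ` K))"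
    using finite_K by (intro card_mono) auto
  also have "\<dots> \<le> Suc (card K)"
    using finite_K card_image_le[of K Suc] by (simp add: card_insert_if)
  finally show ?thesis using initial_outdegree_ge by linarith
qed

text \<open>Otherwise f 1, f (k+1), ..., f (b-1), w, f 2, ..., f k, f b, ..., f p extends the path.
  Here \<open>t w + 2 \<le> b\<close> supplies the arc from \<open>f (b - 1)\<close> to
  \<open>w\<close>, and \<open>k + 2 \<le> b\<close> makes the block before \<open>w\<close>
  nonempty.\<close>

lemma K_no_forward_arc:
  assumes w: "w \<in> R" "2 \<le> t w" and k: "k \<in> K" and b: "t w + 2 \<le> b" "k + 2 \<le> b" "b \<le> p"
  shows "\<not> E (f k) (f b)"
proof -
  have "\<not> E (f (Suc k - 1)) (f (Suc (b - 1)))"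
  proof (rule no_exchange[where j = 2])
    show "E (f (b - 1)) w" using E_iff_t_less[of w "b - 1"] w b by auto
    show "E w (f 2)" using E_iff_le_t[of w 2] w two_le_p by auto
  qed (use w k b in \<open>auto simp: R_def K_def\<close>)
  then show ?thesis using b by simp
qed

text \<open>For any \<open>k\<close> in \<open>K\<close>, the middle vertices \<open>M\<close> of
  the 2-paths from \<open>f k\<close> to \<open>f p\<close> meet \<open>K\<close> at most in p - 1.
  Both sets lie below p, so 2x + x is at most (p - 1) + 1.\<close>

lemma p_ge_3x:
  assumes w: "w \<in> R" "2 \<le> t w" "t w + 2 \<le> p"
  shows "3 * x \<le> p"
proof -
  obtain k where k: "k \<in> K" using card_K_ge x_pos by fastforce
  define M where "M = {l \<in> {1..p}. E (f k) (f l) \<and> E (f l) (f p)}"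
  have M: "x \<le> card M"
    unfolding M_def using k by (intro two_paths_inside) (auto simp: K_def)
  have "K \<inter> M \<subseteq> {p - 1}"
  proof
    fix l assume l: "l \<in> K \<inter> M"
    then have "\<not> l + 2 \<le> p" using K_no_forward_arc[OF w(1,2), of l p] w(3) unfolding M_def by auto
    then show "l \<in> {p - 1}" using l unfolding K_def by auto
  qed
  then have "card (K \<inter> M) \<le> 1" using card_mono[of "{p - 1}"] by fastforce
  moreover have "card K + card M = card (K \<union> M) + card (K \<inter> M)"
    using finite_K by (intro card_Un_Int) (auto simp: M_def)
  moreover have "card (K \<union> M) \<le> card {1..<p}"
  proof (rule card_mono)
    show "K \<union> M \<subseteq> {1..<p}" unfolding K_def M_def using irrefl by (auto simp: le_less)
  qed simp
  ultimately show ?thesis using M card_K_ge two_le_p by simp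
qed

section \<open>Exactly one vertex off the path\<close>

text \<open>For \<open>k\<close> in \<open>K\<close>, the 2-paths from \<open>f k\<close> to
  \<open>w\<close> pass through path vertices beyond \<open>t w\<close>, while arcs from
  \<open>f k\<close> far ahead are forbidden. So the least element of \<open>K\<close> is at least
  \<open>t w + x\<close>, and the 2x elements of \<open>K\<close> lie between it and p.\<close>

lemma t_le_if_single:
  assumes R: "R = {w}"
  shows "t w + 3 * x \<le> p"
proof -
  have w: "w \<in> R" "w \<in> V" using R unfolding R_def by auto
  have "2 * x + 1 \<le> card {v \<in> V. E w v}" using outdegree_ge[OF w(2)] .
  also have "\<dots> \<le> card {i \<in> {1..p}. E w (f i)}"
  proof (rule surj_card_le)
    show "{v \<in> V. E w v} \<subseteq> f ` {i \<in> {1..p}. E w (f i)}"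
    proof
      fix v assume v: "v \<in> {v \<in> V. E w v}"
      then have "v \<noteq> w" using irrefl by blast
      then obtain i where "v = f i" "1 \<le> i" "i \<le> p" using v R on_path[of v] by auto
      then show "v \<in> f ` {i \<in> {1..p}. E w (f i)}" using v by auto
    qed
  qed simp
  finally have t2: "2 \<le> t w" unfolding t_def using x_pos by linarith
  have out: "x \<le> card {b \<in> {t w + 1..p}. E (f k) (f b)}" if k: "k \<in> K" for k
  proof -
    have k1: "1 \<le> k" "k \<le> p" using k unfolding K_def by auto
    then have "x \<le> card {v \<in> V. E (f k) v \<and> E v w}"
      using f_in_V w by (intro two_paths) (auto simp: R_def)
    also have "\<dots> \<le> card {b \<in> {t w + 1..p}. E (f k) (f b)}"
    proof (rule surj_card_le)
      show "{v \<in> V. E (f k) v \<and> E v w} \<subseteq> f ` {b \<in> {t w + 1..p}. E (f k) (f b)}"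
      proof
        fix v assume v: "v \<in> {v \<in> V. E (f k) v \<and> E v w}"
        then have "v \<noteq> w" using irrefl by blast
        then obtain b where "v = f b" "1 \<le> b" "b \<le> p" using v R on_path[of v] by auto
        then show "v \<in> f ` {b \<in> {t w + 1..p}. E (f k) (f b)}"
          using v E_iff_t_less[OF w(1), of b] by auto
      qed
    qed simp
    finally show ?thesis .
  qed
  \<comment> \<open>For \<open>k \<le> t w\<close> the only possible middle vertex is
    \<open>f (t w + 1)\<close>, but at least two are required.\<close>
  have K_gt: "t w < k" if k: "k \<in> K" for k
  proof (rule ccontr)
    assume "\<not> t w < k"
    have "{b \<in> {t w + 1..p}. E (f k) (f b)} \<subseteq> {t w + 1}"
    proof
      fix b assume b: "b \<in> {b \<in> {t w + 1..p}. E (f k) (f b)}"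
      then have "\<not> t w + 2 \<le> b"
        using K_no_forward_arc[OF w(1) t2 k, of b] \<open>\<not> t w < k\<close> by auto
      then show "b \<in> {t w + 1}" using b by auto
    qed
    then have "card {b \<in> {t w + 1..p}. E (f k) (f b)} \<le> 1"
      using card_mono[of "{t w + 1}"] by fastforce
    then show False using out[OF k] x_ge_2 by linarith
  qed
  have "K \<noteq> {}" using card_K_ge x_pos by auto
  define m where "m = Min K"
  have m: "m \<in> K" unfolding m_def using Min_in[OF finite_K \<open>K \<noteq> {}\<close>] .
  \<comment> \<open>The arc to \<open>f (m + 1)\<close> is a path arc and cannot be excluded;
    leaving out m itself gives \<open>m - t w\<close> candidates.\<close>
  have "{b \<in> {t w + 1..p}. E (f m) (f b)} \<subseteq> {t w + 1..m + 1} - {m}"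
  proof
    fix b assume b: "b \<in> {b \<in> {t w + 1..p}. E (f m) (f b)}"
    then have "\<not> m + 2 \<le> b"
      using K_no_forward_arc[OF w(1) t2 m, of b] K_gt[OF m] by auto
    moreover have "b \<noteq> m" using b irrefl by auto
    ultimately show "b \<in> {t w + 1..m + 1} - {m}" using b by auto
  qed
  then have "card {b \<in> {t w + 1..p}. E (f m) (f b)} \<le> card ({t w + 1..m + 1} - {m})"
    by (intro card_mono) auto
  also have "\<dots> = m - t w" using K_gt[OF m] by (simp add: card_Diff_singleton)
  finally have "t w + x \<le> m" using out[OF m] K_gt[OF m] by linarith
  moreover have "card K \<le> card {m..<p}"
  proof (rule card_mono)
    show "K \<subseteq> {m..<p}" using finite_K unfolding m_def K_def by (auto intro: Min_le)
  qed simp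
  moreover have "m < p" using m unfolding K_def by auto
  ultimately show ?thesis using card_K_ge by simp
qed

text \<open>Reversal replaces \<open>t w\<close> by \<open>p - t w\<close>, so both are at least 3x.
  Then n = p + 1 is at least 6x + 1, against \<open>card_bound\<close>.\<close>

lemma card_R_neq_1: "card R \<noteq> 1"
proof
  assume "card R = 1"
  then obtain w where R': "R = {w}" using card_1_singletonE by blast
  interpret rev: stuck_path V "\<lambda>u v. E v u" "\<lambda>i. f (Suc p - i)" p x
    by (rule stuck_path_reverse)
  have w: "w \<in> R" using R' by simp
  have "rev.R = {w}" using R' unfolding rev.R_def R_def reverse_image .
  then have "rev.t w + 3 * x \<le> p" by (rule rev.t_le_if_single)
  moreover have "rev.t w = p - t w"
  proof -
    have "E (f (Suc p - i)) w \<longleftrightarrow> i \<le> p - t w" if "i \<in> {1..p}" for i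
    proof -
      have "1 \<le> Suc p - i" "Suc p - i \<le> p" using that by auto
      then show ?thesis using E_iff_t_less[OF w, of "Suc p - i"] t_le_p[of w] that by auto
    qed
    then have "{i \<in> {1..p}. E (f (Suc p - i)) w} = {1..p - t w}" by auto
    then show ?thesis unfolding rev.t_def by simp
  qed
  ultimately have "6 * x \<le> p" using t_le_if_single[OF R'] by linarith
  then show False using card_bound card_V \<open>card R = 1\<close> x_pos by linarith
qed

section \<open>Two or more vertices off the path\<close>

text \<open>A path vertex \<open>f k\<close> in the middle of a 2-path from w to w' forces
  \<open>t w' < k\<close> and \<open>k \<le> t w\<close>. After sorting \<open>R\<close> by
  \<open>t\<close>, 2-paths to later vertices hence stay in \<open>R\<close>.\<close>

lemma card_R_quadratic: "card R + 2 * x * card R + x * x + x \<le> card R * card R"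
proof -
  obtain ys where ys: "set ys = R" "distinct ys" using finite_distinct_list[OF finite_R] by blast
  define xs where "xs = sort_key t ys"
  have xs: "set xs = R" "distinct xs" "sorted (map t xs)" unfolding xs_def using ys by simp_all
  have len: "length xs = card R" using xs distinct_card by metis
  have in_R: "xs ! i \<in> R" if "i < card R" for i using that xs(1) len nth_mem by metis
  have RV: "R \<subseteq> V" unfolding R_def by auto
  have neq: "xs ! i \<noteq> xs ! j" if "i < card R" "j < card R" "i \<noteq> j" for i j
    using that xs(2) len by (simp add: nth_eq_iff_index_eq)
  show ?thesis
  proof (rule ordered_two_paths_card[of _ "\<lambda>i j. E (xs ! i) (xs ! j)"])
    show "E (xs ! i) (xs ! j) \<longleftrightarrow> \<not> E (xs ! j) (xs ! i)"
      if "i < card R" "j < card R" "i \<noteq> j" for i j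
      using total[of "xs ! i" "xs ! j"] asym in_R neq that RV by blast
    show "x \<le> card {k \<in> {..<card R}. E (xs ! i) (xs ! k) \<and> E (xs ! k) (xs ! j)}" (is "_ \<le> card ?M")
      if ij: "i < j" "j < card R" for i j
    proof -
      have tle: "t (xs ! i) \<le> t (xs ! j)"
        using sorted_nth_mono[OF xs(3), of i j] ij len by simp
      have R2: "xs ! i \<in> R" "xs ! j \<in> R" using in_R ij by auto
      have "{u \<in> V. E (xs ! i) u \<and> E u (xs ! j)} \<subseteq> (!) xs ` ?M"
      proof
        fix u assume u: "u \<in> {u \<in> V. E (xs ! i) u \<and> E u (xs ! j)}"
        have "u \<in> R"
        proof (rule ccontr)
          assume "u \<notin> R"
          then obtain k where "u = f k" "1 \<le> k" "k \<le> p" using u on_path[of u] by auto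
          then show False
            using u tle E_iff_le_t[OF R2(1), of k] E_iff_t_less[OF R2(2), of k] by auto
        qed
        then obtain k where "k < card R" "u = xs ! k" using xs(1) len by (metis in_set_conv_nth)
        then show "u \<in> (!) xs ` ?M" using u by auto
      qed
      then have "card {u \<in> V. E (xs ! i) u \<and> E u (xs ! j)} \<le> card ?M"
        by (intro surj_card_le) auto
      then show ?thesis
        using two_paths[of "xs ! i" "xs ! j"] R2 RV neq[of i j] ij by fastforce
    qed
    show "2 \<le> card R" using card_R_pos card_R_neq_1 by linarith
  qed (rule irrefl)
qed

lemma card_R_ge: "2 * x + 2 \<le> card R"
proof (rule ccontr)
  assume "\<not> ?thesis"
  then have "card R \<le> 2 * x + 1" by linarith
  then have "card R * card R \<le> (2 * x + 1) * card R" by (rule mult_right_mono) simp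
  then show False using card_R_quadratic x_pos by (simp add: algebra_simps)
qed

lemma no_interior_threshold:
  assumes w: "w \<in> R" "2 \<le> t w"
  shows "p < t w + 2"
proof (rule ccontr)
  assume "\<not> ?thesis"
  then have "3 * x \<le> p" using p_ge_3x[OF w] by linarith
  then have r: "7 * card R \<le> 15 * x + 9" using card_bound card_V by linarith
  \<comment> \<open>c + 1 is the factor r - 1 - 2x of the quadratic bound, where r = |R|. It is at
    most (x + 2)/7 and r is at most 3x + 2, too little for a product of x (x + 1) when
    \<open>2 \<le> x\<close>.\<close>
  obtain c where c: "card R = 2 * x + 2 + c" using card_R_ge le_Suc_ex by blast
  have "7 * c + 5 \<le> x" using r c by linarith
  then have "(2 * x + 2 + c) * (7 * (c + 1)) \<le> (2 * x + 2 + c) * (x + 2)"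
    by (intro mult_left_mono) auto
  moreover have "(2 * x + 2 + c) * (x + 2) \<le> (3 * x + 2) * (x + 2)"
    using \<open>7 * c + 5 \<le> x\<close> by (intro mult_right_mono) auto
  moreover have "x * x + x \<le> (2 * x + 2 + c) * (c + 1)"
    using card_R_quadratic unfolding c by (simp add: algebra_simps)
  ultimately have "7 * (x * x + x) \<le> (3 * x + 2) * (x + 2)"
    by (simp add: algebra_simps)
  moreover have "x * 2 \<le> x * x" using x_ge_2 by (intro mult_left_mono) auto
  ultimately show False using x_ge_2 by (simp add: algebra_simps)
qed

section \<open>Thresholds only near the ends of the path\<close>

text \<open>Every threshold is now at most 1 or at least p - 1, so 2-paths among f 2, ..., f (p-1)
  stay on the path. Applying averaging to both neighbourhoods of \<open>f 2\<close> gives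
  \<open>4 * x \<le> p + 1\<close>, hence n is at least 6x + 1.\<close>

lemma contradiction: False
proof -
  have x3: "3 \<le> x" using card_R_ge p_ge card_V card_bound by linarith
  have p6: "6 \<le> p" using p_ge x3 by linarith
  have inside: "x \<le> card {k \<in> {1..p}. E (f i) (f k) \<and> E (f k) (f j)}"
    if "2 \<le> i" "i < p" "2 \<le> j" "j < p" "i \<noteq> j" for i j
    using that no_interior_threshold by (intro two_paths_inside) (auto, fastforce)
  define N where "N = {k \<in> {1..p}. E (f 2) (f k)}"
  define A where "A = {k \<in> {3..<p}. E (f 2) (f k)}"
  define N' where "N' = {k \<in> {1..p}. E (f k) (f 2)}"
  define A' where "A' = {k \<in> {3..<p}. E (f k) (f 2)}"
  have arc12: "E (f 1) (f 2)" and arc23: "E (f 2) (f 3)"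
    using arc[of 1] arc[of 2] p6 by (auto simp: numeral_2_eq_2 numeral_3_eq_3)
  have cases_k: "k = 1 \<or> k = 2 \<or> k \<in> {3..<p} \<or> k = p" if "k \<in> {1..p}" for k using that by auto
  \<comment> \<open>The arc from \<open>f 1\<close> to \<open>f 2\<close> leaves only p as an
    exceptional out-neighbour, whereas in-neighbours may include both 1 and p.\<close>
  have "N - A \<subseteq> {p}"
    using cases_k asym[OF arc12] irrefl unfolding N_def A_def by blast
  then have NA: "card (N - A) \<le> 1" using card_mono[of "{p}"] by fastforce
  have "N' - A' \<subseteq> {1, p}"
    using cases_k irrefl unfolding N'_def A'_def by blast
  then have "card (N' - A') \<le> card {1, p}" by (intro card_mono) auto
  also have "\<dots> = 2" using p6 by simp
  finally have NA': "card (N' - A') \<le> 2" .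
  have "2 * x + 1 \<le> card A + 2 * card (N - A)"
  proof (rule outdegree_bound[of N A "\<lambda>i j. E (f j) (f i)"])
    have "3 \<in> A" using arc23 p6 unfolding A_def by auto
    then show "A \<noteq> {}" by blast
    show "x \<le> card {k \<in> N. E (f k) (f j)}" if "j \<in> A" for j
      using inside[of 2 j] that p6 unfolding A_def N_def by (auto simp: conj_assoc)
    show "E (f j) (f i) \<longleftrightarrow> \<not> E (f i) (f j)" if "i \<in> A" "j \<in> A" "i \<noteq> j" for i j
      using E_f_iff[of j i] that unfolding A_def by auto
  qed (auto simp: A_def N_def irrefl)
  moreover have "2 * x + 1 \<le> card A' + 2 * card (N' - A')"
  proof (rule outdegree_bound[of N' A' "\<lambda>i j. E (f i) (f j)"])
    show *: "x \<le> card {k \<in> N'. E (f j) (f k)}" if "j \<in> A'" for j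
    proof -
      have "{k \<in> N'. E (f j) (f k)} = {k \<in> {1..p}. E (f j) (f k) \<and> E (f k) (f 2)}"
        unfolding N'_def by auto
      then show ?thesis using inside[of j 2] that p6 unfolding A'_def by auto
    qed
    show "A' \<noteq> {}"
    proof
      \<comment> \<open>The 2-paths from \<open>f 3\<close> to \<open>f 2\<close> could then only
        use \<open>f 1\<close> and \<open>f p\<close>, but there are at least three.\<close>
      assume "A' = {}"
      have "{k \<in> {1..p}. E (f 3) (f k) \<and> E (f k) (f 2)} \<subseteq> N' - A'"
        unfolding \<open>A' = {}\<close> N'_def by auto
      then have "card {k \<in> {1..p}. E (f 3) (f k) \<and> E (f k) (f 2)} \<le> card (N' - A')"
        by (intro card_mono) (auto simp: N'_def)
      then show False using inside[of 3 2] NA' x3 p6 by auto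
    qed
    show "E (f i) (f j) \<longleftrightarrow> \<not> E (f j) (f i)" if "i \<in> A'" "j \<in> A'" "i \<noteq> j" for i j
      using E_f_iff[of i j] that unfolding A'_def by auto
  qed (auto simp: A'_def N'_def irrefl)
  moreover have "card A + card A' \<le> p - 3"
  proof -
    have "card A + card A' = card (A \<union> A')"
      using asym by (intro card_Un_disjoint[symmetric]) (auto simp: A_def A'_def)
    also have "\<dots> \<le> card {3..<p}" by (intro card_mono) (auto simp: A_def A'_def)
    finally show ?thesis by simp
  qed
  ultimately have "4 * x \<le> p + 1" using NA NA' p6 by linarith
  then show False using card_R_ge card_V card_bound x3 by linarith
qed

end

section \<open>Path extendability\<close>

lemma vpath_iff_successively:
  "vpath q G \<longleftrightarrow> q \<noteq> [] \<and> set q \<subseteq> verts G \<and> distinct q \<and> successively (\<lambda>u v. u \<rightarrow>\<^bsub>G\<^esub> v) q"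
proof -
  have "set (vwalk_arcs q) \<subseteq> arcs_ends G \<longleftrightarrow> successively (\<lambda>u v. u \<rightarrow>\<^bsub>G\<^esub> v) q"
    by (induction q rule: vwalk_arcs.induct) auto
  then show ?thesis unfolding vpath_def vwalk_def by blast
qed

lemma extendable_by_insertion:
  assumes q: "vpath (as @ bs) G" and ne: "as \<noteq> []" "bs \<noteq> []"
    and w: "w \<in> verts G - set (as @ bs)"
    and arcs: "last as \<rightarrow>\<^bsub>G\<^esub> w" "w \<rightarrow>\<^bsub>G\<^esub> hd bs"
  shows "extendable (as @ bs) G"
proof -
  have "vpath (as @ [w] @ bs) G"
    using q w ne arcs by (auto simp: vpath_iff_successively successively_append_iff successively_Cons)
  then show ?thesis
    unfolding extendable_def using w ne by (intro exI[of _ "as @ [w] @ bs"] exI[of _ w]) auto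
qed

text \<open>The blocks \<open>bs\<close> and \<open>cs\<close> change places with \<open>w\<close>
  between them, which needs exactly the four new arcs in \<open>arcs\<close>.\<close>

lemma extendable_by_exchange:
  assumes q: "vpath (as @ bs @ cs @ ds) G"
    and ne: "as \<noteq> []" "bs \<noteq> []" "cs \<noteq> []" "ds \<noteq> []"
    and w: "w \<in> verts G - set (as @ bs @ cs @ ds)"
    and arcs: "last as \<rightarrow>\<^bsub>G\<^esub> hd cs" "last cs \<rightarrow>\<^bsub>G\<^esub> w" "w \<rightarrow>\<^bsub>G\<^esub> hd bs" "last bs \<rightarrow>\<^bsub>G\<^esub> hd ds"
  shows "extendable (as @ bs @ cs @ ds) G"
proof -
  have "vpath (as @ cs @ [w] @ bs @ ds) G"
    using q w ne arcs by (auto simp: vpath_iff_successively successively_append_iff successively_Cons)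
  then show ?thesis
    unfolding extendable_def using w ne
    by (intro exI[of _ "as @ cs @ [w] @ bs @ ds"] exI[of _ w]) auto
qed

lemma extendable_by_insertion_nth:
  assumes q: "vpath q G" and w: "w \<in> verts G - set q" and i: "1 \<le> i" "i < length q"
    and arcs: "q ! (i - 1) \<rightarrow>\<^bsub>G\<^esub> w" "w \<rightarrow>\<^bsub>G\<^esub> q ! i"
  shows "extendable q G"
proof -
  have "extendable (take i q @ drop i q) G"
  proof (rule extendable_by_insertion)
    have "last (take i q) = q ! (i - 1)" using i by (subst last_conv_nth) (auto simp: min_def)
    then show "last (take i q) \<rightarrow>\<^bsub>G\<^esub> w" using arcs by simp
    show "w \<rightarrow>\<^bsub>G\<^esub> hd (drop i q)" using arcs i by (simp add: hd_drop_conv_nth)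
  qed (use q w i in auto)
  then show ?thesis by simp
qed

lemma extendable_by_exchange_nth:
  assumes q: "vpath q G" and w: "w \<in> verts G - set q"
    and ineq: "2 \<le> j" "j < k" "k \<le> i" "i < length q"
    and arcs: "q ! (j - 2) \<rightarrow>\<^bsub>G\<^esub> q ! (k - 1)" "q ! (i - 1) \<rightarrow>\<^bsub>G\<^esub> w" "w \<rightarrow>\<^bsub>G\<^esub> q ! (j - 1)"
      "q ! (k - 2) \<rightarrow>\<^bsub>G\<^esub> q ! i"
  shows "extendable q G"
proof -
  \<comment> \<open>With f i = \<open>q ! (i - 1)\<close>, the blocks are f 1, ..., f (j-1), then f
    j, ..., f (k-1), then f k, ..., f i, and finally f (i+1), ..., f p.\<close>
  define as where "as = take (j - 1) q"
  define bs where "bs = take (k - j) (drop (j - 1) q)"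
  define cs where "cs = take (Suc i - k) (drop (k - 1) q)"
  define ds where "ds = drop i q"
  have "cs @ ds = drop (k - 1) q"
    unfolding cs_def ds_def using append_take_drop_id[of "Suc i - k" "drop (k - 1) q"] ineq by simp
  then have "bs @ cs @ ds = drop (j - 1) q"
    unfolding bs_def using append_take_drop_id[of "k - j" "drop (j - 1) q"] ineq by simp
  then have eq: "as @ bs @ cs @ ds = q"
    unfolding as_def by simp
  have ne: "as \<noteq> []" "bs \<noteq> []" "cs \<noteq> []" "ds \<noteq> []"
    unfolding as_def bs_def cs_def ds_def using ineq by auto
  have ends: "last as = q ! (j - 2)" "hd bs = q ! (j - 1)" "last bs = q ! (k - 2)"
    "hd cs = q ! (k - 1)" "last cs = q ! (i - 1)" "hd ds = q ! i"
    using ne ineq unfolding as_def bs_def cs_def ds_def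
    by (auto simp: last_conv_nth hd_conv_nth min_def numeral_2_eq_2)
  show ?thesis
    using extendable_by_exchange[of as bs cs ds G w] q w ne arcs unfolding ends eq by blast
qed

text \<open>A path with two arcs and given ends is determined by its middle vertex.\<close>

lemma p2_le_card_common:
  "finite (verts G) \<Longrightarrow> p2 G u v \<le> card {w \<in> verts G. u \<rightarrow>\<^bsub>G\<^esub> w \<and> w \<rightarrow>\<^bsub>G\<^esub> v}"
  unfolding p2_def
proof (rule surj_card_le[where f = "\<lambda>w. [u, w, v]"])
  show "{p. vpath p G \<and> vwalk_length p = 2 \<and> hd p = u \<and> last p = v}
    \<subseteq> (\<lambda>w. [u, w, v]) ` {w \<in> verts G. u \<rightarrow>\<^bsub>G\<^esub> w \<and> w \<rightarrow>\<^bsub>G\<^esub> v}"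
  proof
    fix p assume p: "p \<in> {p. vpath p G \<and> vwalk_length p = 2 \<and> hd p = u \<and> last p = v}"
    then have "length p = 3" by auto
    then obtain a b c where "p = [a, b, c]"
      by (auto simp: numeral_3_eq_3 length_Suc_conv)
    then show "p \<in> (\<lambda>w. [u, w, v]) ` {w \<in> verts G. u \<rightarrow>\<^bsub>G\<^esub> w \<and> w \<rightarrow>\<^bsub>G\<^esub> v}"
      using p by (auto simp: vpath_iff_successively)
  qed
qed simp

lemma pi2_le_p2:
  assumes "finite (verts G)" "u \<in> verts G" "v \<in> verts G" "u \<noteq> v"
  shows "pi2 G \<le> p2 G u v"
  unfolding pi2_def
proof (rule Min_le)
  have "{p2 G u v | u v. u \<in> verts G \<and> v \<in> verts G \<and> u \<noteq> v}
      \<subseteq> (\<lambda>(u, v). p2 G u v) ` (verts G \<times> verts G)"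
    by auto
  then show "finite {p2 G u v | u v. u \<in> verts G \<and> v \<in> verts G \<and> u \<noteq> v}"
    using assms(1) by (meson finite_SigmaI finite_imageI finite_subset)
qed (use assms in blast)

theorem theorem7:
  fixes T :: "('a, 'b) pre_digraph" and n :: nat
  assumes "tournament T"
    and "card (verts T) = n"
    and "real (pi2 T) > (7 * real n - 10) / 36"
  shows "path_extendable T"
  unfolding path_extendable_def
proof (intro allI impI)
  interpret tournament T by fact
  fix q assume "vpath q T \<and> \<not> hamiltonian_path q T \<and> vwalk_length q \<ge> 1"
  then have q: "vpath q T" and psub: "set q \<subset> verts T" and len: "2 \<le> length q"
    by (auto simp: hamiltonian_path_def vpath_iff_successively)
  show "extendable q T"
  proof (rule ccontr)
    assume stuck: "\<not> extendable q T"
    have im: "(\<lambda>i. q ! (i - 1)) ` {1..length q} = set q"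
    proof
      show "set q \<subseteq> (\<lambda>i. q ! (i - 1)) ` {1..length q}"
      proof
        fix v assume "v \<in> set q"
        then obtain i where "i < length q" "v = q ! i" by (auto simp: in_set_conv_nth)
        then show "v \<in> (\<lambda>i. q ! (i - 1)) ` {1..length q}"
          by (intro image_eqI[of _ _ "Suc i"]) auto
      qed
    qed auto
    \<comment> \<open>The list is indexed from 0 and the path from 1, hence the shift in
      \<open>q ! (i - 1)\<close>.\<close>
    have "stuck_path (verts T) (\<lambda>u v. u \<rightarrow>\<^bsub>T\<^esub> v) (\<lambda>i. q ! (i - 1)) (length q) (pi2 T)"
    proof (unfold_locales, unfold im)
      fix u v assume "u \<in> verts T" "v \<in> verts T" "u \<noteq> v"
      then show "pi2 T \<le> card {w \<in> verts T. u \<rightarrow>\<^bsub>T\<^esub> w \<and> w \<rightarrow>\<^bsub>T\<^esub> v}"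
        using pi2_le_p2[of T u v] p2_le_card_common[of T u v] by force
    next
      show "inj_on (\<lambda>i. q ! (i - 1)) {1..length q}"
      proof (rule inj_onI)
        fix i j assume ij: "i \<in> {1..length q}" "j \<in> {1..length q}" "q ! (i - 1) = q ! (j - 1)"
        then have "i - 1 = j - 1"
          using q nth_eq_iff_index_eq[of q "i - 1" "j - 1"] by (auto simp: vpath_def)
        then show "i = j" using ij by auto
      qed
    next
      fix i assume "1 \<le> i" "i < length q"
      then show "q ! (i - 1) \<rightarrow>\<^bsub>T\<^esub> q ! (Suc i - 1)"
        using q successively_nth[of _ q "i - 1"] by (auto simp: vpath_iff_successively)
    next
      fix w i
      assume "w \<in> verts T - set q" "1 \<le> i" "i < length q" "q ! (i - 1) \<rightarrow>\<^bsub>T\<^esub> w"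
      then show "\<not> w \<rightarrow>\<^bsub>T\<^esub> q ! (Suc i - 1)"
        using extendable_by_insertion_nth[OF q, of w i] stuck by auto
    next
      fix w i j k
      assume "w \<in> verts T - set q" "2 \<le> j" "j < k" "k \<le> i" "i < length q"
        "q ! (i - 1) \<rightarrow>\<^bsub>T\<^esub> w" "w \<rightarrow>\<^bsub>T\<^esub> q ! (j - 1)" "q ! (j - 1 - 1) \<rightarrow>\<^bsub>T\<^esub> q ! (k - 1)"
      then show "\<not> q ! (k - 1 - 1) \<rightarrow>\<^bsub>T\<^esub> q ! (Suc i - 1)"
        using extendable_by_exchange_nth[OF q, of w j k i] stuck by (auto simp: numeral_2_eq_2)
    next
      \<comment> \<open>For integers, 36 x > 7 n - 10 is the same as 36 x + 9 \<ge> 7 n.\<close>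
      show "7 * card (verts T) \<le> 36 * pi2 T + 9" using assms(2,3) by simp
    qed (use semicomplete asymmetric psub len in auto)
    then show False by (rule stuck_path.contradiction)
  qed
qed

end
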